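(* Let $I$ be a finite interval in $\mathbb Z$ containing $M$ integers and let $x_m\in\mathbb C$ for $m\in I$. Assume that $K\subset\mathbb N$ is a finite nonempty set. Then \[ \left|\sum_{m\in I}x_m\right|^2\le\frac{M+\max K-\min K}{|K|^2}\sum_{k_1,k_2\in K}\ \sum_{\substack{m\in\mathbb Z\\ m,\,m+k_1-k_2\in I}}x_m\overline{x_{m+k_1-k_2}}. \]
   Context: $\mathbb N$ denotes the set of nonnegative integers and $|K|$ the cardinality of $K$. (The right-hand side is a real number.) *)

theory Defs
  imports Complex_Main
begin

end

theory Submission
  imports Defs "HOL-Analysis.Convex"
begin

text \<open>
  Extend \<open>x\<close> by zero to \<open>y\<close> and put \<open>S n = (\<Sum>k\<in>K. y (n + k))\<close>. The function \<open>S\<close> vanishes off the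
  interval \<open>[a - max K, b - min K]\<close>, which has \<open>M + max K - min K\<close> elements if \<open>M > 0\<close>, and its total
  is \<open>|K|\<close> times the sum of \<open>x\<close>. The claim is the Cauchy-Schwarz inequality for the sum of \<open>S\<close>.
\<close>

lemma cmod_sum_squared_le:
  fixes f :: "'a \<Rightarrow> complex"
  shows "(cmod (\<Sum>n\<in>A. f n))\<^sup>2 \<le> card A * (\<Sum>n\<in>A. (cmod (f n))\<^sup>2)"
proof -
  have "(cmod (\<Sum>n\<in>A. f n))\<^sup>2 \<le> (\<Sum>n\<in>A. cmod (f n))\<^sup>2"
    by (intro power_mono norm_sum norm_ge_zero)
  also have "\<dots> \<le> (\<Sum>n\<in>A. (cmod (f n))\<^sup>2) * card A"
    by (rule sum_squared_le_sum_of_squares)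
  finally show ?thesis by (simp add: mult.commute)
qed

text \<open>The conjugate is put on the \<open>k1\<close> factor, the outer index, so that the terms
  match the claimed bound, where the entry shifted by \<open>k1\<close> is the conjugated
  one.\<close>

lemma cmod_sum_squared_expand:
  fixes f :: "'a \<Rightarrow> complex"
  shows "complex_of_real ((cmod (\<Sum>k\<in>K. f k))\<^sup>2) = (\<Sum>k1\<in>K. \<Sum>k2\<in>K. f k2 * cnj (f k1))"
  by (subst sum.swap) (simp only: complex_norm_square cnj_sum sum_product)

text \<open>Substituting \<open>m = n + int k2\<close> turns \<open>m + int k1 - int k2\<close> into
  \<open>n + int k1\<close>, so each inner sum correlates two shifts of \<open>y\<close>. Once all
  of these run over the same \<open>N\<close>, summation over \<open>n\<close> can be moved outside
  and the squares reassembled. In particular the triple sum is real.\<close>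

lemma window_sum_correlation:
  fixes x :: "int \<Rightarrow> complex" and I N :: "int set" and K :: "nat set"
  assumes "finite N" and window: "\<And>n k. k \<in> K \<Longrightarrow> n + int k \<in> I \<Longrightarrow> n \<in> N"
  defines "y \<equiv> \<lambda>m. if m \<in> I then x m else 0"
  shows "(\<Sum>k1\<in>K. \<Sum>k2\<in>K. \<Sum>m\<in>{m. m \<in> I \<and> m + int k1 - int k2 \<in> I}.
            x m * cnj (x (m + int k1 - int k2)))
         = of_real (\<Sum>n\<in>N. (cmod (\<Sum>k\<in>K. y (n + int k)))\<^sup>2)"
proof -
  have inner: "(\<Sum>m\<in>{m. m \<in> I \<and> m + int k1 - int k2 \<in> I}. x m * cnj (x (m + int k1 - int k2)))
        = (\<Sum>n\<in>N. y (n + int k2) * cnj (y (n + int k1)))" if "k1 \<in> K" "k2 \<in> K" for k1 k2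
  proof -
    have "(\<Sum>m\<in>{m. m \<in> I \<and> m + int k1 - int k2 \<in> I}. x m * cnj (x (m + int k1 - int k2)))
        = (\<Sum>n\<in>{n. n + int k2 \<in> I \<and> n + int k1 \<in> I}. y (n + int k2) * cnj (y (n + int k1)))"
      by (rule sum.reindex_bij_witness[where i = "\<lambda>n. n + int k2" and j = "\<lambda>m. m - int k2"])
        (auto simp: y_def algebra_simps)
    \<comment> \<open>By \<open>window\<close> the index set lies in \<open>N\<close>; at the other
      points of \<open>N\<close> one of the two factors is zero.\<close>
    also have "\<dots> = (\<Sum>n\<in>N. y (n + int k2) * cnj (y (n + int k1)))"
      using \<open>finite N\<close> window that by (intro sum.mono_neutral_left) (auto simp: y_def)
    finally show ?thesis .
  qed
  have "of_real (\<Sum>n\<in>N. (cmod (\<Sum>k\<in>K. y (n + int k)))\<^sup>2)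
      = (\<Sum>n\<in>N. \<Sum>k1\<in>K. \<Sum>k2\<in>K. y (n + int k2) * cnj (y (n + int k1)))"
    by (simp only: of_real_sum cmod_sum_squared_expand)
  also have "\<dots> = (\<Sum>k1\<in>K. \<Sum>k2\<in>K. \<Sum>n\<in>N. y (n + int k2) * cnj (y (n + int k1)))"
    by (subst sum.swap, intro sum.cong refl, rule sum.swap)
  finally show ?thesis using inner by simp
qed

text \<open>For each \<open>k\<close> in \<open>K\<close>, the set \<open>N\<close> contains the
  whole translate of \<open>I\<close> by \<open>-k\<close>, so each \<open>k\<close> contributes the
  full sum of \<open>x\<close>.\<close>

lemma window_sum_total:
  fixes x :: "int \<Rightarrow> complex" and I N :: "int set" and K :: "nat set"
  assumes "finite N" and window: "\<And>n k. k \<in> K \<Longrightarrow> n + int k \<in> I \<Longrightarrow> n \<in> N"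
  shows "(\<Sum>n\<in>N. \<Sum>k\<in>K. if n + int k \<in> I then x (n + int k) else 0) = of_nat (card K) * (\<Sum>m\<in>I. x m)"
proof -
  have "(\<Sum>n\<in>N. if n + int k \<in> I then x (n + int k) else 0) = (\<Sum>m\<in>I. x m)" if "k \<in> K" for k
  proof -
    have "(\<Sum>n\<in>N. if n + int k \<in> I then x (n + int k) else 0) = (\<Sum>n\<in>{n. n + int k \<in> I}. x (n + int k))"
      using assms that by (intro sum.mono_neutral_cong_right) auto
    also have "\<dots> = (\<Sum>m\<in>I. x m)"
      by (rule sum.reindex_bij_witness[where i = "\<lambda>m. m - int k" and j = "\<lambda>n. n + int k"]) auto
    finally show ?thesis .
  qed
  then show ?thesis by (subst sum.swap) simp
qed

theorem proposition6p14:
  fixes I :: "int set" and a b :: int and M :: nat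
    and x :: "int \<Rightarrow> complex" and K :: "nat set"
  assumes "I = {a..b}" and "card I = M"
    and "finite K" and "K \<noteq> {}"
  shows "let R = (of_nat M + of_nat (Max K) - of_nat (Min K)) / (of_nat (card K))\<^sup>2 *
               (\<Sum>k1\<in>K. \<Sum>k2\<in>K. \<Sum>m\<in>{m. m \<in> I \<and> m + int k1 - int k2 \<in> I}.
                  x m * cnj (x (m + int k1 - int k2)))
         in R \<in> \<real> \<and> (cmod (\<Sum>m\<in>I. x m))\<^sup>2 \<le> Re R"
proof (cases "a \<le> b")
  \<comment> \<open>Here \<open>I\<close> is empty and both sides are 0. The case is separate
    because the count of \<open>N\<close> below uses \<open>a \<le> b\<close>.\<close>
  case False
  then show ?thesis using assms(1) by simp
next
  case True
  define N where "N = {a - int (Max K)..b - int (Min K)}"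
  define S where "S n = (\<Sum>k\<in>K. if n + int k \<in> I then x (n + int k) else 0)" for n
  define L :: real where "L = of_nat M + of_nat (Max K) - of_nat (Min K)"
  define E where "E = (\<Sum>n\<in>N. (cmod (S n))\<^sup>2)"
  have window: "n \<in> N" if "k \<in> K" "n + int k \<in> I" for n k
  proof -
    have "Min K \<le> k" "k \<le> Max K" using assms(3) that(1) by auto
    then show ?thesis using that(2) assms(1) by (auto simp: N_def)
  qed
  have "Min K \<le> Max K" using assms(3,4) by simp
  \<comment> \<open>The count is \<open>(b - a + 1) + Max K - Min K\<close>; both inequalities
    together keep it positive, so the conversion to \<open>nat\<close> does not truncate.\<close>
  then have card_N: "real (card N) = L"
    using True assms(1,2) by (auto simp: N_def L_def)
  have card_K: "0 < real (card K)" using assms(3,4) by (simp add: card_gt_0_iff)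
  have correlation: "(\<Sum>k1\<in>K. \<Sum>k2\<in>K. \<Sum>m\<in>{m. m \<in> I \<and> m + int k1 - int k2 \<in> I}.
      x m * cnj (x (m + int k1 - int k2))) = of_real E"
    unfolding E_def S_def by (rule window_sum_correlation[OF _ window]) (auto simp: N_def)
  have total: "(\<Sum>n\<in>N. S n) = of_nat (card K) * (\<Sum>m\<in>I. x m)"
    unfolding S_def by (rule window_sum_total[OF _ window]) (auto simp: N_def)
  have "(real (card K))\<^sup>2 * (cmod (\<Sum>m\<in>I. x m))\<^sup>2 \<le> L * E"
    using cmod_sum_squared_le[of S N]
    by (simp add: total norm_mult power_mult_distrib card_N E_def)
  then have "(cmod (\<Sum>m\<in>I. x m))\<^sup>2 \<le> L / (real (card K))\<^sup>2 * E"
    using card_K by (simp add: field_simps)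
  \<comment> \<open>Writing the complex \<open>R\<close> as an embedded real number gives both
    \<open>R \<in> \<real>\<close> and the value of \<open>Re R\<close>.\<close>
  moreover have "(of_nat M + of_nat (Max K) - of_nat (Min K)) / (of_nat (card K))\<^sup>2 * complex_of_real E
      = of_real (L / (real (card K))\<^sup>2 * E)"
    by (simp add: L_def)
  ultimately show ?thesis
    unfolding correlation Let_def by (simp only: Re_complex_of_real Reals_of_real)
qed

end
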